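(* Let $G=(U,W)$ be a nice bipartite graph. If there exists a vertex $v\in V(G)$ such that $d_G(v)\notin\{d_G(x) : x\in N(v)\}$, then $G$ admits an adjacent vertex-distinguishing $2$-edge-weighting.
   Context: All graphs are finite, undirected and simple. A graph is nice if no connected component of it is a single edge ($K_2$). $G=(U,W)$ means $G$ is bipartite with bipartition $U,W$; $N(v)$ is the set of neighbours of $v$ and $d_G(v)$ its degree. A $k$-edge-weighting of $G$ is a map $w:E(G)\to\{1,\dots,k\}$. For a vertex $v$, let $X_v$ be the multiset of weights of the edges incident with $v$. The edge-weighting is adjacent vertex-distinguishing if $X_u\ne X_v$ for every edge $uv\in E(G)$ (incident edges are allowed to have the same weight).
   Formalization: The graph G is additionally assumed to be connected; without this the statement is false, as the disjoint union of a 6-cycle and a path on three vertices shows. *)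

theory Defs
  imports Main "HOL-Library.Multiset"
begin

definition simple_graph :: "'a set \<Rightarrow> 'a set set \<Rightarrow> bool" where
  "simple_graph V E \<longleftrightarrow> finite V \<and> (\<forall>e\<in>E. e \<subseteq> V \<and> card e = 2)"

definition neighbours :: "'a set set \<Rightarrow> 'a \<Rightarrow> 'a set" where
  "neighbours E v = {u. {u, v} \<in> E}"

definition incident_edges :: "'a set set \<Rightarrow> 'a \<Rightarrow> 'a set set" where
  "incident_edges E v = {e \<in> E. v \<in> e}"

definition degree :: "'a set set \<Rightarrow> 'a \<Rightarrow> nat" where
  "degree E v = card (incident_edges E v)"

definition adj_rel :: "'a set set \<Rightarrow> ('a \<times> 'a) set" where
  "adj_rel E = {(u, v). {u, v} \<in> E}"

definition components :: "'a set \<Rightarrow> 'a set set \<Rightarrow> 'a set set" where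
  "components V E = (\<lambda>v. (adj_rel E)\<^sup>* `` {v}) ` V"

(* A component is represented by its vertex set; it is a single edge (K_2)
   precisely when that vertex set is itself an edge. *)
definition nice :: "'a set \<Rightarrow> 'a set set \<Rightarrow> bool" where
  "nice V E \<longleftrightarrow> (\<forall>C\<in>components V E. C \<notin> E)"

(* Niceness is componentwise, but a single vertex whose degree differs from those
   of its neighbours controls only its own component: the disjoint union of a
   6-cycle and a path on three vertices is nice and bipartite, its vertex of
   degree 2 on the path has only neighbours of degree 1, and yet the 6-cycle has
   no adjacent vertex-distinguishing 2-edge-weighting.  Hence the theorem is
   stated for connected graphs. *)
definition connected_graph :: "'a set \<Rightarrow> 'a set set \<Rightarrow> bool" where
  "connected_graph V E \<longleftrightarrow> V \<noteq> {} \<and> (\<forall>u\<in>V. \<forall>v\<in>V. (u, v) \<in> (adj_rel E)\<^sup>*)"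

definition bipartition :: "'a set \<Rightarrow> 'a set set \<Rightarrow> 'a set \<Rightarrow> 'a set \<Rightarrow> bool" where
  "bipartition V E U W \<longleftrightarrow> U \<union> W = V \<and> U \<inter> W = {} \<and>
     (\<forall>e\<in>E. \<exists>u\<in>U. \<exists>w\<in>W. e = {u, w})"

definition edge_weighting :: "nat \<Rightarrow> 'a set set \<Rightarrow> ('a set \<Rightarrow> nat) \<Rightarrow> bool" where
  "edge_weighting k E w \<longleftrightarrow> (\<forall>e\<in>E. w e \<in> {1..k})"

definition incident_weights :: "'a set set \<Rightarrow> ('a set \<Rightarrow> nat) \<Rightarrow> 'a \<Rightarrow> nat multiset" where
  "incident_weights E w v = image_mset w (mset_set (incident_edges E v))"

definition adjacent_vertex_distinguishing ::
    "'a set set \<Rightarrow> ('a set \<Rightarrow> nat) \<Rightarrow> bool" where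
  "adjacent_vertex_distinguishing E w \<longleftrightarrow>
     (\<forall>u v. {u, v} \<in> E \<longrightarrow> incident_weights E w u \<noteq> incident_weights E w v)"

end

theory Submission imports Defs begin

text \<open>
  With weights 1 and 2 the multiset at a vertex is determined by its degree and by the number of
  incident edges of weight 2. Two adjacent vertices are therefore distinguished as soon as
  their degrees differ, or the numbers of edges of weight 2 at them have different parities.

  Let \<open>v\<close> be a vertex whose degree differs from those of all its neighbours. Every edge at \<open>v\<close> is
  then taken care of by degrees, so the parity at \<open>v\<close> is free. In a connected graph the degree
  parities of an edge set can be prescribed arbitrarily at all vertices but one
  (\<open>parity_prescription_off_root\<close>): to flip the parity at \<open>a\<close>, take the symmetric difference with
  a path from \<open>v\<close> to \<open>a\<close>, which affects only \<open>a\<close> and \<open>v\<close>. Giving weight 2 to a set of edges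
  with odd degree at the vertices of \<open>U\<close> and even degree at the vertices of \<open>W\<close>, except
  possibly at \<open>v\<close>, separates the ends of every edge that avoids \<open>v\<close>.
\<close>

lemma odd_card_sym_diff:
  assumes "finite A" "finite B"
  shows "odd (card (sym_diff A B)) \<longleftrightarrow> (odd (card A) \<noteq> odd (card B))"
proof -
  have "card (sym_diff A B) = card (A - B) + card (B - A)"
    using assms by (intro card_Un_disjoint) auto
  moreover have "card A = card (A \<inter> B) + card (A - B)"
    using assms by (subst card_Un_disjoint[symmetric]) (auto intro: arg_cong[where f = card])
  moreover have "card B = card (A \<inter> B) + card (B - A)"
    using assms by (subst card_Un_disjoint[symmetric]) (auto intro: arg_cong[where f = card])
  ultimately show ?thesis by auto
qed

lemma odd_degree_sym_diff:
  assumes "finite A" "finite B"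
  shows "odd (degree (sym_diff A B) x) \<longleftrightarrow> (odd (degree A x) \<noteq> odd (degree B x))"
proof -
  have "incident_edges (sym_diff A B) x = sym_diff (incident_edges A x) (incident_edges B x)"
    by (auto simp: incident_edges_def)
  then show ?thesis
    using assms by (simp add: degree_def odd_card_sym_diff incident_edges_def)
qed

lemma degree_single_edge: "degree {e} x = (if x \<in> e then 1 else 0)"
proof -
  have "incident_edges {e} x = (if x \<in> e then {e} else {})"
    by (auto simp: incident_edges_def)
  then show ?thesis by (simp add: degree_def)
qed

lemma simple_graph_finite_edges: "simple_graph V E \<Longrightarrow> finite E"
  unfolding simple_graph_def by (rule finite_subset[of E "Pow V"]) auto

text \<open>
  A walk is turned into an edge set by keeping the edges used an odd number of times. At each
  inner visit the walk enters and leaves, so only its two ends can have odd degree; for a closed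
  walk there is no odd vertex.
\<close>

lemma walk_parity:
  assumes "simple_graph V E" "(a, b) \<in> (adj_rel E)\<^sup>*"
  shows "\<exists>S\<subseteq>E. \<forall>x. odd (degree S x) \<longleftrightarrow> (x = a) \<noteq> (x = b)"
  using assms(2)
proof (induction rule: rtrancl_induct)
  case base
  show ?case by (rule exI[of _ "{}"]) (simp add: degree_def incident_edges_def)
next
  case (step y z)
  then obtain S where S: "S \<subseteq> E" "\<And>x. odd (degree S x) \<longleftrightarrow> (x = a) \<noteq> (x = y)"
    by blast
  have e: "{y, z} \<in> E" using step.hyps by (simp add: adj_rel_def)
  then have "card {y, z} = 2" using assms(1) by (auto simp: simple_graph_def)
  then have "y \<noteq> z" by auto
  have "finite S"
    using S(1) simple_graph_finite_edges[OF assms(1)] by (rule finite_subset)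
  then have "odd (degree (sym_diff S {{y, z}}) x) \<longleftrightarrow> (x = a) \<noteq> (x = z)" for x
    using S(2)[of x] \<open>y \<noteq> z\<close> by (auto simp: odd_degree_sym_diff degree_single_edge)
  moreover have "sym_diff S {{y, z}} \<subseteq> E" using S(1) e by auto
  ultimately show ?case by blast
qed

text \<open>
  By the handshake lemma the parities cannot be prescribed at all vertices; the root absorbs the
  defect.
\<close>

lemma parity_prescription_off_root:
  assumes "simple_graph V E" "finite T" "\<And>a. a \<in> T \<Longrightarrow> (r, a) \<in> (adj_rel E)\<^sup>*"
  shows "\<exists>S\<subseteq>E. \<forall>x. x \<noteq> r \<longrightarrow> (odd (degree S x) \<longleftrightarrow> x \<in> T)"
  using assms(2,3)
proof (induction rule: finite_induct)
  case empty
  show ?case by (rule exI[of _ "{}"]) (simp add: degree_def incident_edges_def)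
next
  case (insert a T)
  then obtain S where S: "S \<subseteq> E" "\<And>x. x \<noteq> r \<Longrightarrow> odd (degree S x) \<longleftrightarrow> x \<in> T"
    by blast
  obtain P where P: "P \<subseteq> E" "\<And>x. odd (degree P x) \<longleftrightarrow> (x = r) \<noteq> (x = a)"
    using walk_parity[OF assms(1), of r a] insert.prems by blast
  have "finite S" "finite P"
    using S(1) P(1) simple_graph_finite_edges[OF assms(1)] by (auto intro: finite_subset)
  then have "odd (degree (sym_diff S P) x) \<longleftrightarrow> x \<in> insert a T" if "x \<noteq> r" for x
    using S(2)[OF that] P(2)[of x] that insert.hyps by (auto simp: odd_degree_sym_diff)
  moreover have "sym_diff S P \<subseteq> E" using S(1) P(1) by auto
  ultimately show ?case by blast
qed

lemma size_incident_weights: "size (incident_weights E w x) = degree E x"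
  by (simp add: incident_weights_def degree_def)

lemma count_incident_weights_indicator:
  assumes "finite E" "S \<subseteq> E"
  shows "count (incident_weights E (\<lambda>e. if e \<in> S then 2 else 1) x) 2 = degree S x"
proof -
  have "{e \<in> incident_edges E x. (if e \<in> S then 2 else 1) = (2::nat)} = incident_edges S x"
    using assms(2) by (auto simp: incident_edges_def)
  then show ?thesis
    using assms(1)
    by (simp add: incident_weights_def degree_def count_conv_size_mset filter_mset_image_mset
        incident_edges_def)
qed

theorem theorem3p1:
  fixes V U W :: "'a set" and E :: "'a set set"
  assumes "simple_graph V E"
    and "bipartition V E U W"
    and "nice V E"
    and "connected_graph V E"
    and "\<exists>v\<in>V. degree E v \<notin> degree E ` neighbours E v"
  shows "\<exists>w. edge_weighting 2 E w \<and> adjacent_vertex_distinguishing E w"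
proof -
  obtain v where v: "v \<in> V" "degree E v \<notin> degree E ` neighbours E v"
    using assms(5) by blast
  have finE: "finite E" using assms(1) by (rule simple_graph_finite_edges)
  have "U \<subseteq> V" using assms(2) by (auto simp: bipartition_def)
  then have "finite U"
    using assms(1) by (auto simp: simple_graph_def intro: finite_subset)
  moreover have "(v, a) \<in> (adj_rel E)\<^sup>*" if "a \<in> U" for a
    using assms(4) v(1) \<open>U \<subseteq> V\<close> that by (auto simp: connected_graph_def)
  ultimately obtain S where S: "S \<subseteq> E" "\<And>x. x \<noteq> v \<Longrightarrow> odd (degree S x) \<longleftrightarrow> x \<in> U"
    using parity_prescription_off_root[OF assms(1), of U v] by blast
  define w :: "'a set \<Rightarrow> nat" where "w = (\<lambda>e. if e \<in> S then 2 else 1)"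
  have "incident_weights E w x \<noteq> incident_weights E w y" if e: "{x, y} \<in> E" for x y
  proof
    assume eq: "incident_weights E w x = incident_weights E w y"
    then have deg: "degree E x = degree E y" by (metis size_incident_weights)
    have "x \<in> neighbours E y" "y \<in> neighbours E x"
      using e by (auto simp: neighbours_def insert_commute)
    then have "x \<noteq> v" "y \<noteq> v"
      using v(2) deg by (metis imageI)+
    moreover have "degree S x = degree S y"
      using eq count_incident_weights_indicator[OF finE S(1)] unfolding w_def by metis
    ultimately have "x \<in> U \<longleftrightarrow> y \<in> U" using S(2) by metis
    then show False
      using assms(2) e unfolding bipartition_def by (fastforce simp: doubleton_eq_iff)
  qed
  moreover have "edge_weighting 2 E w" by (simp add: edge_weighting_def w_def)
  ultimately show ?thesis unfolding adjacent_vertex_distinguishing_def by blast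
qed

end
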